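(* Let $P\in\mathbb{R}^{n\times n}$ be an irreducible and aperiodic Markov transition matrix with strictly positive stationary distribution $\pi$, let $D_\pi=\operatorname{diag}(\pi_1,\dots,\pi_n)$, $U_{\perp1}=I_n-\mathbf{1}\pi^\top$ and $L=I_n-P$, so that the chain is ergodic with $\rho(PU_{\perp1})<1$. Then the relaxation time $\tau_{\mathrm{rel}}=1/\sigma_{n-1}(L)$ satisfies $$\left\|D_\pi^{1/2}\Big(\sum_{k=0}^\infty P^kU_{\perp1}\Big)D_\pi^{-1/2}\right\|_{\ell^2(\mathbb{R}^n)}=\frac{1}{\sigma_{n-1}(L)}.$$
   Context: $P$ is row-stochastic ($n\ge2$), $\pi^\top P=\pi^\top$, $\pi_i>0$ for all $i$, $\sum_i\pi_i=1$; $\mathbf{1}$ is the all-ones column vector; $\rho$ denotes spectral radius. $\ell^2(\pi)$ is $\mathbb{R}^n$ with inner product $\langle f,g\rangle_\pi=\sum_if_ig_i\pi_i$, and $\|\cdot\|_{\ell^2(\mathbb{R}^n)}$ is the Euclidean operator (spectral) norm. $\sigma_1(L)\ge\dots\ge\sigma_n(L)=0$ are the singular values of $L$ on $\ell^2(\pi)$ (square roots of the eigenvalues of $LL^*$, with $L^*$ the $\ell^2(\pi)$-adjoint, counted with multiplicity); by the variational formulation, $\sigma_{n-1}(L)=\inf\{\|Lf\|_{\ell^2(\pi)}:\langle f,\mathbf{1}\rangle_\pi=0,\|f\|_{\ell^2(\pi)}=1\}$. *)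

theory Defs
  imports "HOL-Analysis.Analysis" "HOL-Computational_Algebra.Computational_Algebra"
begin

primrec matpow :: "'a::comm_ring_1^'n^'n \<Rightarrow> nat \<Rightarrow> 'a^'n^'n" where
  "matpow A 0 = mat 1"
| "matpow A (Suc k) = A ** matpow A k"

definition diag :: "'a::zero^'n \<Rightarrow> 'a^'n^'n" where
  "diag d = (\<chi> i j. if i = j then d $ i else 0)"

definition charpoly :: "'a::comm_ring_1^'n^'n \<Rightarrow> 'a poly" where
  "charpoly A = det (\<chi> i j. (if i = j then [:0, 1:] else 0) - [:A $ i $ j:])"

definition is_eigenvalue :: "'a::field^'n^'n \<Rightarrow> 'a \<Rightarrow> bool" where
  "is_eigenvalue A z \<longleftrightarrow> (\<exists>v. v \<noteq> 0 \<and> A *v v = z *s v)"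

(* The eigenvalues that count are the complex ones. Their set is finite and
   nonempty, so the supremum is the maximum. *)
definition spectral_radius :: "real^'n^'n \<Rightarrow> real" where
  "spectral_radius A = Sup (cmod ` {z. is_eigenvalue (map_matrix complex_of_real A) z})"

definition row_stochastic :: "real^'n^'n \<Rightarrow> bool" where
  "row_stochastic P \<longleftrightarrow> (\<forall>i j. 0 \<le> P $ i $ j) \<and> (\<forall>i. (\<Sum>j\<in>UNIV. P $ i $ j) = 1)"

definition irreducible_chain :: "real^'n^'n \<Rightarrow> bool" where
  "irreducible_chain P \<longleftrightarrow> (\<forall>i j. \<exists>k. 0 < matpow P k $ i $ j)"

definition aperiodic_chain :: "real^'n^'n \<Rightarrow> bool" where
  "aperiodic_chain P \<longleftrightarrow> (\<forall>i. Gcd {k. 0 < k \<and> 0 < matpow P k $ i $ i} = 1)"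

definition positive_stationary :: "real^'n^'n \<Rightarrow> real^'n \<Rightarrow> bool" where
  "positive_stationary P \<pi> \<longleftrightarrow>
     \<pi> v* P = \<pi> \<and> (\<forall>i. 0 < \<pi> $ i) \<and> (\<Sum>i\<in>UNIV. \<pi> $ i) = 1"

definition U_perp1 :: "real^'n \<Rightarrow> real^'n^'n" where
  "U_perp1 \<pi> = mat 1 - (\<chi> i j. \<pi> $ j)"

definition inner_pi :: "real^'n \<Rightarrow> real^'n \<Rightarrow> real^'n \<Rightarrow> real" where
  "inner_pi \<pi> f g = (\<Sum>i\<in>UNIV. f $ i * g $ i * \<pi> $ i)"

definition adjoint_pi :: "real^'n \<Rightarrow> real^'n^'n \<Rightarrow> real^'n^'n" where
  "adjoint_pi \<pi> A = (THE B. \<forall>f g. inner_pi \<pi> (A *v f) g = inner_pi \<pi> f (B *v g))"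

lemma adjoint_pi_exists_unique:
  fixes \<pi> :: "real^'n"
  assumes pos: "\<And>i. 0 < \<pi> $ i"
  shows "\<exists>!B. \<forall>f g. inner_pi \<pi> (A *v f) g = inner_pi \<pi> f (B *v g)"
proof (rule ex1I)
  let ?B = "(\<chi> i j. A $ j $ i * \<pi> $ j / \<pi> $ i) :: real^'n^'n"
  show B: "\<forall>f g. inner_pi \<pi> (A *v f) g = inner_pi \<pi> f (?B *v g)"
  proof (intro allI)
    fix f g :: "real^'n"
    have "inner_pi \<pi> (A *v f) g = (\<Sum>i\<in>UNIV. \<Sum>j\<in>UNIV. A $ i $ j * f $ j * g $ i * \<pi> $ i)"
      by (simp add: inner_pi_def matrix_vector_mult_def sum_distrib_right)
    also have "\<dots> = (\<Sum>j\<in>UNIV. \<Sum>i\<in>UNIV. A $ i $ j * f $ j * g $ i * \<pi> $ i)"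
      by (rule sum.swap)
    also have "\<dots> = inner_pi \<pi> f (?B *v g)"
      unfolding inner_pi_def matrix_vector_mult_def
      using less_imp_neq[OF pos, symmetric]
      by (intro sum.cong refl) (simp add: sum_distrib_left sum_distrib_right mult_ac)
    finally show "inner_pi \<pi> (A *v f) g = inner_pi \<pi> f (?B *v g)" .
  qed
  fix C :: "real^'n^'n"
  assume C: "\<forall>f g. inner_pi \<pi> (A *v f) g = inner_pi \<pi> f (C *v g)"
  have "(C *v g) $ k = (?B *v g) $ k" for g k
  proof -
    have ax: "inner_pi \<pi> (axis k 1) h = h $ k * \<pi> $ k" for h
      by (simp add: inner_pi_def axis_def if_distrib[of "\<lambda>x. x * _"] cong: if_cong)
    have "inner_pi \<pi> (axis k 1) (C *v g) = inner_pi \<pi> (axis k 1) (?B *v g)"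
      using B C by metis
    then show ?thesis
      using pos[of k] by (simp add: ax)
  qed
  then show "C = ?B"
    by (simp add: matrix_eq vec_eq_iff)
qed

(* Singular values of A on l^2(\<pi>): square roots of the eigenvalues of A A^*,
   counted with multiplicity, in decreasing order. All n roots of the
   characteristic polynomial are real and nonnegative when \<pi> is positive. *)
definition singular_values_pi :: "real^'n \<Rightarrow> real^'n^'n \<Rightarrow> real list" where
  "singular_values_pi \<pi> A =
     rev (map sqrt (sorted_list_of_multiset (proots (charpoly (A ** adjoint_pi \<pi> A)))))"

(* One-based: k = 1 is the largest, k = CARD('n) the smallest. *)
definition singular_value_pi :: "real^'n \<Rightarrow> real^'n^'n \<Rightarrow> nat \<Rightarrow> real" where
  "singular_value_pi \<pi> A k = singular_values_pi \<pi> A ! (k - 1)"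

definition relaxation_time :: "real^'n \<Rightarrow> real^'n^'n \<Rightarrow> real" where
  "relaxation_time \<pi> P = 1 / singular_value_pi \<pi> (mat 1 - P) (CARD('n) - 1)"

end

theory Submission
  imports Defs
begin

text \<open>Conjugation by \<open>D\<^sub>\<pi>\<^sup>1\<^sup>/\<^sup>2\<close> turns \<open>\<ell>\<^sup>2(\<pi>)\<close> into Euclidean space. Let \<open>S\<close> and \<open>W\<close> be the conjugates of \<open>L = I - P\<close>
  and of \<open>Z = (\<Sum>k. P\<^sup>k U)\<close>, and let \<open>u = (\<surd>\<pi>\<^sub>i)\<close>. Telescoping gives \<open>L Z = Z L = U\<close>, so that \<open>S W = W S\<close>
  is the orthogonal projection onto the complement of the unit vector \<open>u\<close>, and \<open>u\<close> spans the
  kernels of \<open>S\<^sup>T\<close> and \<open>W\<close>. Hence \<open>W\<^sup>T\<close> inverts \<open>S\<^sup>T\<close> on that complement, and its norm is \<open>1 / \<surd>\<mu>\<close>, where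
  \<open>\<mu>\<close> is the least eigenvalue of \<open>S S\<^sup>T\<close> (which is similar to \<open>L L\<^sup>*\<close>) apart from the simple
  eigenvalue \<open>0\<close>. Convergence and the bound on the spectral radius come from a Doeblin minorization of
  some power \<open>P\<^sup>m\<close> with strictly positive entries.\<close>

section \<open>Self-adjoint maps and characteristic polynomials\<close>

text \<open>For small \<open>t\<close> of the sign of \<open>a\<close> the linear term dominates.
  This is the first-order condition at a maximum.\<close>

lemma quadratic_le_0_imp_linear_eq_0:
  fixes a c :: real
  assumes "\<And>t. 2 * t * a + t\<^sup>2 * c \<le> 0"
  shows "a = 0"
proof (rule ccontr)
  assume "a \<noteq> 0"
  \<comment> \<open>The denominator is chosen so that the expression becomes
    \<open>t\<^sup>2\<close> times a factor that is at least 2 whatever the sign of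
    \<open>c\<close>.\<close>
  define t where "t = a / (\<bar>c\<bar> + 1)"
  have "t * (\<bar>c\<bar> + 1) = a" by (simp add: t_def)
  then have "2 * t * a + t\<^sup>2 * c = t\<^sup>2 * (2 * \<bar>c\<bar> + 2 + c)"
    by (simp add: power2_eq_square algebra_simps flip: \<open>t * (\<bar>c\<bar> + 1) = a\<close>)
  moreover have "t\<^sup>2 > 0" using \<open>a \<noteq> 0\<close> by (simp add: t_def)
  moreover have "2 * \<bar>c\<bar> + 2 + c > 0" by linarith
  ultimately have "2 * t * a + t\<^sup>2 * c > 0" by simp
  with assms[of t] show False by simp
qed

text \<open>The quadratic form \<open>x \<bullet> f x\<close> attains its maximum on the compact
  unit sphere of \<open>V\<close>. A maximizer \<open>v\<close> is an eigenvector: the residual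
  \<open>w\<close> lies in \<open>V\<close> by invariance, and varying \<open>v\<close> in the
  direction \<open>w\<close> forces \<open>w \<bullet> w = 0\<close>.\<close>

lemma self_adjoint_eigenvector_in_subspace:
  fixes f :: "'a::euclidean_space \<Rightarrow> 'a"
  assumes lin: "linear f" and adj: "\<And>x y. f x \<bullet> y = x \<bullet> f y"
    and V: "subspace V" and inv: "\<And>x. x \<in> V \<Longrightarrow> f x \<in> V" and nz: "\<exists>x\<in>V. x \<noteq> 0"
  obtains v c where "v \<in> V" "norm v = 1" "f v = c *\<^sub>R v"
proof -
  let ?K = "V \<inter> sphere 0 1"
  have "compact ?K" using V by (simp add: closed_Int_compact closed_subspace)
  moreover obtain x where x: "x \<in> V" "x \<noteq> 0" using nz by blast
  then have "x /\<^sub>R norm x \<in> ?K" using V by (simp add: subspace_scale)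
  then have "?K \<noteq> {}" by blast
  moreover have "continuous_on ?K (\<lambda>x. x \<bullet> f x)"
    using linear_continuous_on[OF linear_conv_bounded_linear[THEN iffD1, OF lin]]
    by (intro continuous_intros)
  ultimately obtain v where v: "v \<in> ?K" and max: "\<And>x. x \<in> ?K \<Longrightarrow> x \<bullet> f x \<le> v \<bullet> f v"
    using continuous_attains_sup by metis
  define m where "m = v \<bullet> f v"
  define w where "w = f v - m *\<^sub>R v"
  have vV: "v \<in> V" and nv: "norm v = 1" using v by auto
  have wV: "w \<in> V" unfolding w_def using V vV inv by (simp add: subspace_diff subspace_scale)
  have le: "x \<bullet> f x \<le> m * (x \<bullet> x)" if "x \<in> V" for x
  proof (cases "x = 0")
    case True then show ?thesis by simp
  next
    case False
    have "x /\<^sub>R norm x \<in> ?K" using V that False by (simp add: subspace_scale)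
    from max[OF this] have "(x \<bullet> f x) / (norm x)\<^sup>2 \<le> m"
      by (simp add: linear_scale[OF lin] m_def power2_eq_square divide_inverse mult_ac)
    then show ?thesis
      using False by (simp add: divide_le_eq power2_norm_eq_inner)
  qed
  \<comment> \<open>This is \<open>le\<close> at \<open>v + t *\<^sub>R w\<close>; the constant
    terms and those in \<open>w \<bullet> v\<close> cancel.\<close>
  have "2 * t * (w \<bullet> w) + t\<^sup>2 * (w \<bullet> f w - m * (w \<bullet> w)) \<le> 0" for t
  proof -
    have "v + t *\<^sub>R w \<in> V" using V vV wV by (simp add: subspace_add subspace_scale)
    from le[OF this]
    have "(v + t *\<^sub>R w) \<bullet> (f v + t *\<^sub>R f w) \<le> m * ((v + t *\<^sub>R w) \<bullet> (v + t *\<^sub>R w))"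
      by (simp only: linear_add[OF lin] linear_scale[OF lin])
    moreover have "(v + t *\<^sub>R w) \<bullet> (f v + t *\<^sub>R f w) = m + 2 * t * (w \<bullet> f v) + t\<^sup>2 * (w \<bullet> f w)"
      using adj[of v w] by (simp add: inner_add_left inner_add_right m_def inner_commute[of "f v"]
          power2_eq_square algebra_simps)
    moreover have "(v + t *\<^sub>R w) \<bullet> (v + t *\<^sub>R w) = 1 + 2 * t * (w \<bullet> v) + t\<^sup>2 * (w \<bullet> w)"
      using nv by (simp add: inner_add_left inner_add_right norm_eq_1 inner_commute[of v w]
          power2_eq_square algebra_simps)
    moreover have "w \<bullet> f v = w \<bullet> w + m * (w \<bullet> v)"
      by (subst (2) w_def) (simp add: inner_diff_right)
    ultimately have "m + 2 * t * (w \<bullet> w + m * (w \<bullet> v)) + t\<^sup>2 * (w \<bullet> f w)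
        \<le> m * (1 + 2 * t * (w \<bullet> v) + t\<^sup>2 * (w \<bullet> w))"
      by (simp only:)
    then show ?thesis
      by (simp add: algebra_simps)
  qed
  then have "w \<bullet> w = 0" by (rule quadratic_le_0_imp_linear_eq_0)
  then have "f v = m *\<^sub>R v" by (simp add: w_def)
  with that vV nv show thesis by blast
qed

text \<open>Take a largest orthonormal set of eigenvectors containing \<open>B\<close>. If it did
  not span, its orthogonal complement would be nonzero and invariant under \<open>f\<close>, hence
  would supply one more unit eigenvector.\<close>

lemma self_adjoint_orthonormal_eigenbasis_extend:
  fixes f :: "'a::euclidean_space \<Rightarrow> 'a"
  assumes lin: "linear f" and adj: "\<And>x y. f x \<bullet> y = x \<bullet> f y"
    and "pairwise orthogonal B" "\<And>b. b \<in> B \<Longrightarrow> norm b = 1" "\<And>b. b \<in> B \<Longrightarrow> \<exists>c. f b = c *\<^sub>R b"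
  obtains B' where "B \<subseteq> B'" "pairwise orthogonal B'" "\<And>b. b \<in> B' \<Longrightarrow> norm b = 1"
    "\<And>b. b \<in> B' \<Longrightarrow> \<exists>c. f b = c *\<^sub>R b" "card B' = DIM('a)"
proof -
  define good where "good C \<longleftrightarrow> B \<subseteq> C \<and> pairwise orthogonal C \<and> (\<forall>b\<in>C. norm b = 1)
     \<and> (\<forall>b\<in>C. \<exists>c. f b = c *\<^sub>R b)" for C
  have indep: "independent C" if "good C" for C
    using that unfolding good_def by (intro pairwise_orthogonal_independent) force+
  have bound: "card C \<le> DIM('a)" if "good C" for C
    using independent_bound[OF indep[OF that]] by simp
  have "good B" using assms by (simp add: good_def)
  then obtain C where C: "good C" and max: "\<And>C'. good C' \<Longrightarrow> card C' \<le> card C"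
    using ex_has_greatest_nat[of good B card "DIM('a) + 1"] bound by (auto simp: less_Suc_eq_le)
  have finC: "finite C" using independent_bound[OF indep[OF C]] by simp
  have "card C = DIM('a)"
  proof (rule ccontr)
    assume "card C \<noteq> DIM('a)"
    then have "card C < DIM('a)" using bound[OF C] by simp
    then have "span C \<noteq> UNIV"
      by (metis indep[OF C] dim_UNIV dim_span_eq_card_independent less_irrefl)
    then obtain a where a: "a \<noteq> 0" "\<And>x. x \<in> span C \<Longrightarrow> orthogonal a x"
      using orthogonal_to_subspace_exists_gen[of C UNIV] by (auto simp: span_UNIV)
    define V where "V = {x. \<forall>b\<in>C. x \<bullet> b = 0}"
    have "subspace V" by (auto simp: V_def subspace_def inner_add_left)
    moreover have "f x \<in> V" if "x \<in> V" for x
    proof -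
      have "f x \<bullet> b = 0" if b: "b \<in> C" for b
      proof -
        obtain c where "f b = c *\<^sub>R b" using C b unfolding good_def by blast
        then show ?thesis using adj[of x b] \<open>x \<in> V\<close> b by (simp add: V_def)
      qed
      then show ?thesis by (simp add: V_def)
    qed
    moreover have "\<exists>x\<in>V. x \<noteq> 0"
      using a by (auto simp: V_def orthogonal_def intro!: bexI[of _ a] span_base)
    ultimately obtain v c where v: "v \<in> V" "norm v = 1" "f v = c *\<^sub>R v"
      using self_adjoint_eigenvector_in_subspace[OF lin adj] by metis
    have "v \<notin> C"
    proof
      assume "v \<in> C"
      then have "v \<bullet> v = 0" using v by (simp add: V_def)
      then show False using v by simp
    qed
    moreover have "good (insert v C)"
      using C v by (auto simp: good_def pairwise_insert V_def orthogonal_def inner_commute)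
    ultimately show False using max[of "insert v C"] finC by simp
  qed
  then show thesis using that[of C] C by (auto simp: good_def)
qed

text \<open>With \<open>R\<close> embedded as a matrix of constant polynomials, the similarity lifts
  to the polynomial matrices \<open>X A\<close> and \<open>X (diag d)\<close>. Their determinants
  agree because the nonzero \<open>det (?C R)\<close> cancels in a ring without zero
  divisors.\<close>

lemma charpoly_similar_diag:
  fixes A R R' :: "'a::field^'n^'n" and d :: "'a^'n"
  assumes AR: "A ** R = R ** diag d" and inv: "R ** R' = mat 1"
  shows "charpoly A = (\<Prod>i\<in>UNIV. [:- (d $ i), 1:])"
proof -
  define X :: "'a^'n^'n \<Rightarrow> 'a poly^'n^'n"
    where "X M = (\<chi> i j. (if i = j then [:0, 1:] else 0) - [:M $ i $ j:])" for M
  let ?C = "map_matrix (\<lambda>a::'a. [:a:])"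
  have const_sum: "(\<Sum>k\<in>K. [:g k:]) = [:\<Sum>k\<in>K. g k:]" for g :: "'n \<Rightarrow> 'a" and K
    by (induction K rule: infinite_finite_induct) auto
  have C_mult: "?C M ** ?C N = ?C (M ** N)" for M N :: "'a^'n^'n"
    by (simp add: vec_eq_iff matrix_matrix_mult_def const_sum mult.commute)
  have XC: "X M ** ?C N = (\<chi> i j. [:0, 1:] * [:N $ i $ j:]) - ?C (M ** N)" for M N :: "'a^'n^'n"
    by (simp add: X_def vec_eq_iff matrix_matrix_mult_def sum_subtractf const_sum smult_diff_right
        if_distrib[of "smult _"] mult.commute cong: if_cong)
  have CX: "?C N ** X M = (\<chi> i j. [:0, 1:] * [:N $ i $ j:]) - ?C (N ** M)" for M N :: "'a^'n^'n"
    by (simp add: X_def vec_eq_iff matrix_matrix_mult_def right_diff_distrib sum_subtractf const_sum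
        if_distrib[of "\<lambda>x. _ * x"] mult.commute cong: if_cong)
  \<comment> \<open>Both sides are \<open>R\<close> times the indeterminate minus the constant
    matrix \<open>A ** R = R ** diag d\<close>.\<close>
  have "X A ** ?C R = ?C R ** X (diag d)"
    by (simp add: XC CX AR)
  then have "det (X A) * det (?C R) = det (?C R) * det (X (diag d))"
    by (metis det_mul)
  moreover have "det (?C R) \<noteq> 0"
  proof -
    have "?C R ** ?C R' = mat 1"
      by (auto simp: C_mult inv vec_eq_iff mat_def one_pCons)
    then show ?thesis by (metis det_I det_mul mult_zero_left zero_neq_one)
  qed
  ultimately have "det (X A) = det (X (diag d))" by (simp add: mult.commute)
  also have "\<dots> = (\<Prod>i\<in>UNIV. X (diag d) $ i $ i)"
    by (rule det_diagonal) (simp add: X_def diag_def)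
  finally show ?thesis by (simp add: charpoly_def X_def diag_def)
qed

lemma proots_charpoly_similar_diag:
  fixes A R R' :: "'a::field^'n^'n" and d :: "'a^'n"
  assumes "A ** R = R ** diag d" and "R ** R' = mat 1"
  shows "proots (charpoly A) = image_mset (($) d) (mset_set UNIV)"
proof -
  have "proots (charpoly A) = (\<Sum>i\<in>UNIV. {#d $ i#})"
    unfolding charpoly_similar_diag[OF assms] by (subst proots_prod) auto
  then show ?thesis by (simp add: sum_unfold_sum_mset image_mset.compositionality o_def sum_mset_singleton_mset)
qed

section \<open>Ergodicity\<close>

text \<open>The least positive difference \<open>d\<close> of two elements of \<open>T\<close>
  divides every element, so it is 1. Then \<open>T\<close> contains two consecutive numbers
  \<open>a\<close> and \<open>a + 1\<close>, whose combinations reach every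
  \<open>n \<ge> a * a\<close>.\<close>

lemma additive_set_Gcd_1_cofinite:
  fixes T :: "nat set"
  assumes zero: "0 \<in> T" and add: "\<And>a b. a \<in> T \<Longrightarrow> b \<in> T \<Longrightarrow> a + b \<in> T" and gcd: "Gcd T = 1"
  shows "\<exists>N. \<forall>n\<ge>N. n \<in> T"
proof -
  have mult: "q * a \<in> T" if "a \<in> T" for q a
    using that by (induction q) (auto intro: zero add)
  define D where "D d \<longleftrightarrow> 0 < d \<and> (\<exists>a\<in>T. a + d \<in> T)" for d
  have "\<not> T \<subseteq> {0}"
  proof
    assume "T \<subseteq> {0}"
    then have "T = {0}" using zero by blast
    with gcd show False by simp
  qed
  then obtain t where "t \<in> T" "t > 0" by auto
  then have "D t" unfolding D_def using zero by (metis add_0)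
  define d where "d = (LEAST d. D d)"
  have "D d" unfolding d_def by (rule LeastI) fact
  then obtain a where a: "a \<in> T" "a + d \<in> T" and "d > 0" by (auto simp: D_def)
  have "d dvd t" if "t \<in> T" for t
  proof (rule ccontr)
    assume "\<not> d dvd t"
    define q r where "q = t div d" and "r = t mod d"
    have r: "0 < r" "r < d" and t: "t = q * d + r"
      using \<open>\<not> d dvd t\<close> \<open>d > 0\<close> by (auto simp: q_def r_def dvd_eq_mod_eq_0)
    \<comment> \<open>\<open>T\<close> is closed only under sums, so the remainder \<open>r\<close>
      is not itself exhibited as a difference. Instead \<open>Suc q * (a + d)\<close> exceeds this
      element by \<open>d - r\<close>, a positive difference smaller than \<open>d\<close>.\<close>
    have "t + Suc q * a \<in> T" using that a mult add by blast
    moreover have "(t + Suc q * a) + (d - r) = Suc q * (a + d)"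
      using r by (simp add: t algebra_simps)
    then have "(t + Suc q * a) + (d - r) \<in> T" using mult[OF a(2)] by metis
    ultimately have "D (d - r)" unfolding D_def using r by auto
    then have "d \<le> d - r" unfolding d_def by (rule Least_le)
    with r show False by simp
  qed
  then have "d dvd Gcd T" by (rule Gcd_greatest)
  with gcd have d: "d = 1" by simp
  \<comment> \<open>For \<open>a > 0\<close>, use \<open>n mod a\<close> copies of
    \<open>a + 1\<close> and \<open>n div a - n mod a\<close> copies of \<open>a\<close>; the bound
    on \<open>n\<close> keeps the latter count nonnegative.\<close>
  have "n \<in> T" if "n \<ge> a * a" for n
  proof (cases "a = 0")
    case True
    then show ?thesis using mult[OF a(2), of n] d by simp
  next
    case False
    have "n mod a < a" using False by simp
    also have "a \<le> n div a" using that False by (simp add: less_eq_div_iff_mult_less_eq)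
    finally have "n = (n div a - n mod a) * a + n mod a * (a + d)"
      using d by (simp add: algebra_simps diff_mult_distrib2 mult_le_mono)
    then show ?thesis using mult a add by metis
  qed
  then show ?thesis by blast
qed

section \<open>Powers of a stochastic matrix and primitivity\<close>

lemma matpow_add: "matpow A (m + n) = matpow A m ** matpow A n"
  by (induction m) (auto simp: matrix_mul_assoc)

lemma row_stochastic_nonneg: "row_stochastic P \<Longrightarrow> 0 \<le> P $ i $ j"
  and row_stochastic_sum: "row_stochastic P \<Longrightarrow> (\<Sum>j\<in>UNIV. P $ i $ j) = 1"
  by (auto simp: row_stochastic_def)

lemma row_stochastic_mult:
  assumes "row_stochastic P" "row_stochastic Q"
  shows "row_stochastic (P ** Q)"
proof -
  have "(\<Sum>j\<in>UNIV. \<Sum>k\<in>UNIV. P $ i $ k * Q $ k $ j) = 1" for i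
    using assms by (subst sum.swap) (simp add: row_stochastic_sum flip: sum_distrib_left)
  then show ?thesis
    using assms by (auto simp: row_stochastic_def matrix_matrix_mult_def intro!: sum_nonneg)
qed

lemma row_stochastic_matpow: "row_stochastic P \<Longrightarrow> row_stochastic (matpow P k)"
proof (induction k)
  case 0
  then show ?case by (simp add: row_stochastic_def mat_def)
qed (simp add: row_stochastic_mult)

lemma matpow_add_pos:
  assumes "row_stochastic P" "0 < matpow P m $ i $ k" "0 < matpow P n $ k $ j"
  shows "0 < matpow P (m + n) $ i $ j"
proof -
  have "0 < matpow P m $ i $ k * matpow P n $ k $ j" using assms by simp
  also have "\<dots> \<le> (\<Sum>l\<in>UNIV. matpow P m $ i $ l * matpow P n $ l $ j)"
    by (rule member_le_sum)
      (auto intro!: mult_nonneg_nonneg row_stochastic_nonneg row_stochastic_matpow assms(1))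
  finally show ?thesis by (simp add: matpow_add matrix_matrix_mult_def)
qed

text \<open>The return times to \<open>i\<close> form an additive set with gcd 1, so they include
  all large times. Appending a path from \<open>i\<close> to \<open>j\<close> makes each entry
  eventually positive, and finitely many entries share a common exponent.\<close>

lemma irreducible_aperiodic_imp_primitive:
  fixes P :: "real^'n^'n"
  assumes P: "row_stochastic P" and irr: "irreducible_chain P" and aper: "aperiodic_chain P"
  shows "\<exists>m>0. \<forall>i j. 0 < matpow P m $ i $ j"
proof -
  have "\<forall>\<^sub>F k in sequentially. 0 < matpow P k $ i $ j" for i j
  proof -
    let ?T = "{k. 0 < matpow P k $ i $ i}"
    \<comment> \<open>Aperiodicity concerns positive return times only; adjoining 0, as the additive
      set requires, leaves the gcd unchanged.\<close>
    have "?T = insert 0 {k. 0 < k \<and> 0 < matpow P k $ i $ i}"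
      by (auto simp: mat_def intro: gr0I)
    then have "Gcd ?T = 1" using aper by (simp add: aperiodic_chain_def)
    then obtain N where N: "\<And>n. n \<ge> N \<Longrightarrow> 0 < matpow P n $ i $ i"
      using additive_set_Gcd_1_cofinite[of ?T] matpow_add_pos[OF P, of _ i i _ i]
      by (auto simp: mat_def)
    obtain l where l: "0 < matpow P l $ i $ j" using irr by (auto simp: irreducible_chain_def)
    have "0 < matpow P k $ i $ j" if "k \<ge> N + l" for k
      using matpow_add_pos[OF P N[of "k - l"] l] that by simp
    then show ?thesis by (auto simp: eventually_sequentially)
  qed
  then have "\<forall>\<^sub>F k in sequentially. \<forall>i j. 0 < matpow P k $ i $ j"
    by (intro eventually_all_finite)
  from eventually_conj[OF this eventually_gt_at_top[of 0]] show ?thesis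
    by (auto dest: eventually_happens)
qed

lemma stationary_matpow: "\<pi> v* P = \<pi> \<Longrightarrow> \<pi> v* matpow P k = \<pi>"
  by (induction k) (auto simp flip: vector_matrix_mul_assoc)

text \<open>Doeblin minorization: subtracting \<open>\<epsilon> \<pi>\<close> from each row does not change the action on
  vectors of \<open>\<pi>\<close>-mean zero, and lowers the row sums to \<open>1 - \<epsilon>\<close>. The vectors may have entries in
  any normed space, so that the same bound serves for real vectors and for complex eigenvectors.\<close>

lemma doeblin_contraction:
  fixes M :: "real^'n^'n" and \<pi> :: "real^'n" and g :: "'n \<Rightarrow> 'a::real_normed_vector"
  assumes M: "row_stochastic M" and minor: "\<And>i j. \<epsilon> * \<pi> $ j \<le> M $ i $ j"
    and sum_pi: "(\<Sum>i\<in>UNIV. \<pi> $ i) = 1"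
    and mean: "(\<Sum>j\<in>UNIV. \<pi> $ j *\<^sub>R g j) = 0" and B: "\<And>j. norm (g j) \<le> B"
  shows "norm (\<Sum>j\<in>UNIV. M $ i $ j *\<^sub>R g j) \<le> (1 - \<epsilon>) * B"
proof -
  have "(\<Sum>j\<in>UNIV. (M $ i $ j - \<epsilon> * \<pi> $ j) *\<^sub>R g j)
      = (\<Sum>j\<in>UNIV. M $ i $ j *\<^sub>R g j) - \<epsilon> *\<^sub>R (\<Sum>j\<in>UNIV. \<pi> $ j *\<^sub>R g j)"
    by (simp add: scaleR_left_diff_distrib sum_subtractf scaleR_sum_right)
  then have "norm (\<Sum>j\<in>UNIV. M $ i $ j *\<^sub>R g j) = norm (\<Sum>j\<in>UNIV. (M $ i $ j - \<epsilon> * \<pi> $ j) *\<^sub>R g j)"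
    by (simp add: mean)
  also have "\<dots> \<le> (\<Sum>j\<in>UNIV. (M $ i $ j - \<epsilon> * \<pi> $ j) * B)"
    using minor B by (intro sum_norm_le) (auto intro!: mult_left_mono)
  also have "\<dots> = (1 - \<epsilon>) * B"
    using row_stochastic_sum[OF M] sum_pi
    by (simp add: sum_subtractf flip: sum_distrib_right sum_distrib_left)
  finally show ?thesis .
qed

text \<open>A real matrix acts here on families with values in any real vector space, so that it
  applies to real columns and to complex eigenvectors alike.\<close>

definition mat_act :: "real^'n^'m \<Rightarrow> ('n \<Rightarrow> 'a::real_vector) \<Rightarrow> 'm \<Rightarrow> 'a" where
  "mat_act M g i = (\<Sum>j\<in>UNIV. M $ i $ j *\<^sub>R g j)"

lemma mat_act_mult: "mat_act (M ** N) g = mat_act M (mat_act N g)"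
proof
  fix i
  have "mat_act (M ** N) g i = (\<Sum>j\<in>UNIV. \<Sum>k\<in>UNIV. (M $ i $ k * N $ k $ j) *\<^sub>R g j)"
    by (simp add: mat_act_def matrix_matrix_mult_def scaleR_sum_left)
  also have "\<dots> = mat_act M (mat_act N g) i"
    by (subst sum.swap) (simp add: mat_act_def scaleR_sum_right)
  finally show "mat_act (M ** N) g i = mat_act M (mat_act N g) i" .
qed

text \<open>In particular mean zero is preserved, which allows the contraction to be
  iterated.\<close>

lemma stationary_mean_mat_act:
  assumes "\<pi> v* M = \<pi>"
  shows "(\<Sum>i\<in>UNIV. \<pi> $ i *\<^sub>R mat_act M g i) = (\<Sum>j\<in>UNIV. \<pi> $ j *\<^sub>R g j)"
proof -
  have "(\<Sum>i\<in>UNIV. \<pi> $ i *\<^sub>R mat_act M g i) = (\<Sum>i\<in>UNIV. \<Sum>j\<in>UNIV. (\<pi> $ i * M $ i $ j) *\<^sub>R g j)"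
    by (simp add: mat_act_def scaleR_sum_right)
  also have "\<dots> = (\<Sum>j\<in>UNIV. (\<pi> v* M) $ j *\<^sub>R g j)"
    by (subst sum.swap) (simp add: vector_matrix_mult_def scaleR_sum_left)
  finally show ?thesis by (simp add: assms)
qed

text \<open>Every block of \<open>m\<close> steps, with \<open>P^m\<close> entrywise positive,
  shrinks the sup bound of a mean-zero family by a fixed factor, and the remaining
  \<open>k mod m\<close> steps do not increase it.\<close>

lemma ergodic_contraction:
  fixes P :: "real^'n^'n" and \<pi> :: "real^'n"
  assumes P: "row_stochastic P" and irr: "irreducible_chain P" and aper: "aperiodic_chain P"
    and pi: "positive_stationary P \<pi>"
  shows "\<exists>m>0. \<exists>c. 0 < c \<and> c < 1 \<and> (\<forall>(g :: 'n \<Rightarrow> 'a::real_normed_vector) B k i.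
    (\<Sum>j\<in>UNIV. \<pi> $ j *\<^sub>R g j) = 0 \<longrightarrow> (\<forall>j. norm (g j) \<le> B) \<longrightarrow>
    norm (mat_act (matpow P k) g i) \<le> c ^ (k div m) * B)"
proof -
  obtain m where m: "m > 0" and prim: "\<And>i j. 0 < matpow P m $ i $ j"
    using irreducible_aperiodic_imp_primitive[OF P irr aper] by blast
  have stat: "\<pi> v* P = \<pi>" and sum_pi: "(\<Sum>i\<in>UNIV. \<pi> $ i) = 1" and pos: "\<And>i. 0 < \<pi> $ i"
    using pi by (auto simp: positive_stationary_def)
  have pi_le: "\<pi> $ i \<le> 1" for i
    unfolding sum_pi[symmetric] by (rule member_le_sum) (auto simp: less_imp_le pos)
  \<comment> \<open>The least entry of \<open>P^m\<close> gives the minorization because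
    \<open>\<pi> $ j \<le> 1\<close>; the cap 1/2 keeps the contraction factor
    \<open>1 - \<epsilon>\<close> strictly positive.\<close>
  define \<epsilon> where "\<epsilon> = min (1/2) (Min (range (\<lambda>(i, j). matpow P m $ i $ j)))"
  have eps: "0 < \<epsilon>" "\<epsilon> < 1" using prim by (auto simp: \<epsilon>_def)
  have minor: "\<epsilon> * \<pi> $ j \<le> matpow P m $ i $ j" for i j
  proof -
    have "\<epsilon> * \<pi> $ j \<le> \<epsilon>" using eps pi_le[of j] by (simp add: mult_left_le)
    also have "\<dots> \<le> matpow P m $ i $ j"
      unfolding \<epsilon>_def by (rule min.coboundedI2, rule Min_le) (auto intro: image_eqI[of _ _ "(i, j)"])
    finally show ?thesis .
  qed
  have bound: "norm (mat_act (matpow P k) g i) \<le> (1 - \<epsilon>) ^ (k div m) * B"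
    if mean: "(\<Sum>j\<in>UNIV. \<pi> $ j *\<^sub>R g j) = 0" and B: "\<And>j. norm (g j) \<le> B"
    for g :: "'n \<Rightarrow> 'a" and B k i
    using that
  proof (induction k arbitrary: g B i rule: less_induct)
    case (less k)
    show ?case
    proof (cases "k < m")
      case True
      \<comment> \<open>Minorization constant 0: a stochastic matrix does not increase the sup
        bound.\<close>
      have "norm (mat_act (matpow P k) g i) \<le> (1 - 0) * B"
        unfolding mat_act_def using less.prems
        by (intro doeblin_contraction[where \<pi> = \<pi>] row_stochastic_matpow[OF P] sum_pi)
          (auto intro: row_stochastic_nonneg row_stochastic_matpow[OF P])
      with True show ?thesis by simp
    next
      case False
      have "norm (mat_act (matpow P m) g j) \<le> (1 - \<epsilon>) * B" for j
        unfolding mat_act_def using less.prems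
        by (intro doeblin_contraction[where \<pi> = \<pi>] row_stochastic_matpow[OF P] sum_pi minor)
      moreover have "(\<Sum>j\<in>UNIV. \<pi> $ j *\<^sub>R mat_act (matpow P m) g j) = 0"
        using less.prems(1) by (simp add: stationary_mean_mat_act stationary_matpow[OF stat])
      ultimately have "norm (mat_act (matpow P (k - m)) (mat_act (matpow P m) g) i)
          \<le> (1 - \<epsilon>) ^ ((k - m) div m) * ((1 - \<epsilon>) * B)"
        using False m by (intro less.IH) auto
      moreover have "matpow P k = matpow P (k - m) ** matpow P m"
        using False by (simp flip: matpow_add)
      moreover have "k div m = Suc ((k - m) div m)" using False m by (simp add: le_div_geq)
      ultimately show ?thesis by (simp add: mat_act_mult mult_ac)
    qed
  qed
  have "0 < 1 - \<epsilon>" "1 - \<epsilon> < 1" using eps by auto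
  with m bound show ?thesis by blast
qed

section \<open>Convergence of the series and the spectral radius\<close>

lemma summable_power_div:
  fixes c :: real
  assumes "0 < c" "c < 1" "0 < m"
  shows "summable (\<lambda>k. c ^ (k div m))"
proof -
  \<comment> \<open>The geometric ratio per single step; rounding \<open>k\<close> down to a
    multiple of \<open>m\<close> costs at most one factor \<open>1 / c\<close>.\<close>
  define r where "r = root m c"
  have r: "0 < r" "r < 1" "r ^ m = c" using assms by (auto simp: r_def)
  show ?thesis
  proof (rule summable_comparison_test')
    show "summable (\<lambda>k. r ^ k / c)" using r by (intro summable_divide summable_geometric) auto
    show "norm (c ^ (k div m)) \<le> r ^ k / c" for k
    proof -
      have "r ^ m * r ^ (m * (k div m)) = r ^ (m + m * (k div m))" by (simp add: power_add)
      also have "\<dots> \<le> r ^ k"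
      proof (rule power_decreasing)
        have "k mod m < m" using assms by simp
        then show "k \<le> m + m * (k div m)"
          using mult_div_mod_eq[of m k] by linarith
      qed (use r in auto)
      finally show ?thesis using assms r by (simp add: power_mult le_divide_eq mult.commute)
    qed
  qed
qed

lemma summable_matrix_componentwise:
  fixes f :: "nat \<Rightarrow> real^'n^'m"
  assumes "\<And>i j k. \<bar>f k $ i $ j\<bar> \<le> h k" "summable h"
  shows "summable f"
proof (rule summable_comparison_test')
  show "summable (\<lambda>k. real CARD('m) * (real CARD('n) * h k))"
    by (intro summable_mult assms)
  show "norm (f k) \<le> real CARD('m) * (real CARD('n) * h k)" for k
  proof -
    have "norm (f k $ i) \<le> real CARD('n) * h k" for i
    proof -
      have "norm (f k $ i) \<le> (\<Sum>j\<in>UNIV. \<bar>f k $ i $ j\<bar>)" by (rule norm_le_l1_cart)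
      also have "\<dots> \<le> (\<Sum>j\<in>(UNIV::'n set). h k)" by (intro sum_mono assms)
      finally show ?thesis by simp
    qed
    then have "(\<Sum>i\<in>UNIV. norm (f k $ i)) \<le> (\<Sum>i\<in>(UNIV::'m set). real CARD('n) * h k)"
      by (intro sum_mono)
    moreover have "norm (f k) \<le> (\<Sum>i\<in>UNIV. norm (f k $ i))"
      unfolding norm_vec_def by (rule L2_set_le_sum) simp
    ultimately show ?thesis by simp
  qed
qed

lemma U_perp1_mult_vec: "U_perp1 \<pi> *v x = (\<chi> i. x $ i - \<pi> \<bullet> x)"
  by (simp add: U_perp1_def matrix_vector_mult_diff_rdistrib vec_eq_iff inner_vec_def)
    (simp add: matrix_vector_mult_def)

text \<open>Each column of \<open>U_perp1 \<pi>\<close> has mean zero and entries of modulus at most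
  1, so the contraction bounds all entries of the k-th term by \<open>c ^ (k div m)\<close>.\<close>

lemma ergodic_summable:
  fixes P :: "real^'n^'n" and \<pi> :: "real^'n"
  assumes "row_stochastic P" "irreducible_chain P" "aperiodic_chain P" "positive_stationary P \<pi>"
  shows "summable (\<lambda>k. matpow P k ** U_perp1 \<pi>)"
proof -
  have sum_pi: "(\<Sum>i\<in>UNIV. \<pi> $ i) = 1" and pos: "\<And>i. 0 < \<pi> $ i"
    using assms(4) by (auto simp: positive_stationary_def)
  have pi_le: "\<pi> $ i \<le> 1" for i
    unfolding sum_pi[symmetric] by (rule member_le_sum) (auto simp: less_imp_le pos)
  obtain m c where mc: "0 < m" "0 < c" "c < 1"
    and contr: "\<forall>(g :: 'n \<Rightarrow> real) B k i. (\<Sum>j\<in>UNIV. \<pi> $ j *\<^sub>R g j) = 0 \<longrightarrow>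
      (\<forall>j. norm (g j) \<le> B) \<longrightarrow> norm (mat_act (matpow P k) g i) \<le> c ^ (k div m) * B"
    using ergodic_contraction[OF assms, where 'a = real] by blast
  have "\<bar>(matpow P k ** U_perp1 \<pi>) $ i $ j\<bar> \<le> c ^ (k div m) * 1" for k i j
  proof -
    define g where "g l = U_perp1 \<pi> $ l $ j" for l
    have g: "g l = (if l = j then 1 else 0) - \<pi> $ j" for l
      by (simp add: g_def U_perp1_def mat_def)
    have "(\<Sum>l\<in>UNIV. \<pi> $ l *\<^sub>R g l) = 0"
      by (simp add: g right_diff_distrib sum_subtractf sum_pi if_distrib[of "\<lambda>x. _ * x"]
          cong: if_cong flip: sum_distrib_right)
    moreover have "norm (g l) \<le> 1" for l
      using pi_le[of j] pos[of j] by (simp add: g)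
    ultimately have "norm (mat_act (matpow P k) g i) \<le> c ^ (k div m) * 1" using contr by blast
    then show ?thesis by (simp add: mat_act_def g_def matrix_matrix_mult_def)
  qed
  then show ?thesis
    using summable_matrix_componentwise[OF _ summable_power_div[OF mc(2,3,1)], of "\<lambda>k. matpow P k ** U_perp1 \<pi>"]
    by simp
qed

text \<open>An eigenvector for \<open>z \<noteq> 0\<close> lies in the range of
  \<open>P ** U_perp1 \<pi>\<close>, hence has mean zero. It is then fixed by
  \<open>U_perp1 \<pi>\<close> and is an eigenvector of \<open>P\<close>, so the contraction limits
  \<open>cmod z\<close>.\<close>

lemma ergodic_spectral_radius_less_1:
  fixes P :: "real^'n^'n" and \<pi> :: "real^'n"
  assumes P: "row_stochastic P" and "irreducible_chain P" "aperiodic_chain P" and pi: "positive_stationary P \<pi>"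
  shows "spectral_radius (P ** U_perp1 \<pi>) < 1"
proof -
  let ?Q = "P ** U_perp1 \<pi>"
  have sum_pi: "(\<Sum>i\<in>UNIV. \<pi> $ i) = 1" and stat: "\<pi> v* P = \<pi>"
    using pi by (auto simp: positive_stationary_def)
  obtain m c where mc: "0 < m" "0 < c" "c < 1"
    and contr: "\<forall>(g :: 'n \<Rightarrow> complex) B k i. (\<Sum>j\<in>UNIV. \<pi> $ j *\<^sub>R g j) = 0 \<longrightarrow>
      (\<forall>j. norm (g j) \<le> B) \<longrightarrow> norm (mat_act (matpow P k) g i) \<le> c ^ (k div m) * B"
    using ergodic_contraction[OF assms, where 'a = complex] by blast
  have bound: "cmod z \<le> root m c" if ev: "is_eigenvalue (map_matrix complex_of_real ?Q) z" for z
  proof (cases "z = 0")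
    case True
    then show ?thesis using mc by simp
  next
    case False
    obtain v where "v \<noteq> 0" and v: "map_matrix complex_of_real ?Q *v v = z *s v"
      using ev by (auto simp: is_eigenvalue_def)
    define g where "g j = v $ j" for j
    define \<mu> where "\<mu> = (\<Sum>j\<in>UNIV. \<pi> $ j *\<^sub>R g j)"
    have U_act: "mat_act (U_perp1 \<pi>) g i = g i - \<mu>" for i
      by (simp add: mat_act_def U_perp1_def scaleR_left_diff_distrib sum_subtractf \<mu>_def mat_def
          if_distrib[of "\<lambda>x. x *\<^sub>R _"] cong: if_cong)
    have Qg: "mat_act ?Q g = (\<lambda>i. z * g i)"
    proof
      fix i
      have "mat_act ?Q g i = (map_matrix complex_of_real ?Q *v v) $ i"
        unfolding mat_act_def by (simp add: matrix_vector_mult_def g_def scaleR_conv_of_real)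
      then show "mat_act ?Q g i = z * g i" by (simp add: v g_def)
    qed
    have "(\<Sum>i\<in>UNIV. \<pi> $ i *\<^sub>R mat_act (U_perp1 \<pi>) g i) = 0"
      unfolding U_act
      by (simp add: scaleR_right_diff_distrib sum_subtractf sum_pi flip: scaleR_sum_left \<mu>_def)
    then have "(\<Sum>i\<in>UNIV. \<pi> $ i *\<^sub>R mat_act ?Q g i) = 0"
      by (simp add: mat_act_mult stationary_mean_mat_act[OF stat])
    then have "z * \<mu> = 0" by (simp add: Qg \<mu>_def sum_distrib_left)
    then have \<mu>: "\<mu> = 0" using False by simp
    have Pg: "mat_act P g = (\<lambda>i. z * g i)"
    proof -
      have "mat_act (U_perp1 \<pi>) g = g" by (auto simp: U_act \<mu>)
      then show ?thesis using Qg by (simp add: mat_act_mult)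
    qed
    have Pkg: "mat_act (matpow P k) g = (\<lambda>i. z ^ k * g i)" for k
    proof (induction k)
      case 0
      show ?case by (simp add: fun_eq_iff mat_act_def mat_def if_distrib[of "\<lambda>x. x *\<^sub>R _"] cong: if_cong)
    next
      case (Suc k)
      have "mat_act P (\<lambda>i. z ^ k * g i) = (\<lambda>i. z ^ k * mat_act P g i)"
        by (simp add: fun_eq_iff mat_act_def sum_distrib_left)
      then show ?case by (simp add: mat_act_mult Suc Pg mult_ac)
    qed
    define B where "B = Max (range (\<lambda>j. norm (g j)))"
    have B: "norm (g j) \<le> B" for j by (simp add: B_def)
    have "B \<in> range (\<lambda>j. norm (g j))" unfolding B_def by (rule Max_in) auto
    then obtain i where i: "norm (g i) = B" by auto
    obtain j where "g j \<noteq> 0" using \<open>v \<noteq> 0\<close> by (auto simp: vec_eq_iff g_def)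
    then have "B > 0" using B[of j] by (meson less_le_trans zero_less_norm_iff)
    \<comment> \<open>At an index \<open>i\<close> of maximal modulus the left side is
      \<open>cmod z ^ m * B\<close>, and \<open>B > 0\<close> can be divided out.\<close>
    have "norm (mat_act (matpow P m) g i) \<le> c ^ (m div m) * B"
      using contr \<mu> B unfolding \<mu>_def by blast
    then have "cmod z ^ m \<le> c"
      using mc \<open>B > 0\<close> by (simp add: Pkg norm_mult norm_power i)
    then have "root m (cmod z ^ m) \<le> root m c" using mc by simp
    then show ?thesis using mc by (simp add: real_root_power_cancel)
  qed
  \<comment> \<open>The constant vector makes 0 an eigenvalue, so the supremum is taken over a
    nonempty set.\<close>
  have "mat_act ?Q (\<lambda>i. 1 :: complex) i = 0" for i
    by (simp add: mat_act_mult)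
      (simp add: mat_act_def U_perp1_def scaleR_conv_of_real mat_def sum_subtractf flip: of_real_sum of_real_diff add: sum_pi)
  then have "map_matrix complex_of_real ?Q *v 1 = 0 *s 1"
    by (simp add: vec_eq_iff matrix_vector_mult_def mat_act_def scaleR_conv_of_real)
  then have "is_eigenvalue (map_matrix complex_of_real ?Q) 0"
    unfolding is_eigenvalue_def by (intro exI[of _ 1]) auto
  then have "spectral_radius ?Q \<le> root m c"
    unfolding spectral_radius_def using bound by (intro cSup_least) auto
  also have "\<dots> < 1" using mc by simp
  finally show ?thesis .
qed

section \<open>Singular values and the operator norm\<close>

lemma diag_mult_component: "(diag d ** M) $ i $ j = d $ i * M $ i $ j"
  and mult_diag_component: "(M ** diag d) $ i $ j = M $ i $ j * d $ j"
  for M :: "'a::comm_ring_1^'n^'n" and d :: "'a^'n"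
  by (simp_all add: diag_def matrix_matrix_mult_def if_distrib[of "\<lambda>x. x * _"]
      if_distrib[of "\<lambda>x. _ * x"] cong: if_cong)

lemma diag_mult_vec_component: "(diag d *v x) $ i = d $ i * x $ i"
  for x :: "'a::comm_ring_1^'n" and d :: "'a^'n"
  by (simp add: diag_def matrix_vector_mult_def if_distrib[of "\<lambda>x. x * _"] cong: if_cong)

lemma transpose_diag: "transpose (diag d) = diag d"
  by (auto simp: transpose_def diag_def vec_eq_iff)

text \<open>Extend \<open>{u}\<close> to an orthonormal eigenbasis and use it as the columns of
  \<open>Q\<close>. Prescribing \<open>u\<close> as a column lets its eigenvalue be set apart by
  index, whatever its multiplicity.\<close>

lemma spectral_decomposition_with_eigenvector:
  fixes A :: "real^'n^'n"
  assumes sym: "transpose A = A" and Au: "A *v u = c *\<^sub>R u" and u: "norm u = 1"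
  obtains Q :: "real^'n^'n" and d :: "real^'n" and i
  where "orthogonal_matrix Q" "A ** Q = Q ** diag d" "column i Q = u"
proof -
  have adj: "(A *v x) \<bullet> y = x \<bullet> (A *v y)" for x y
    by (metis sym dot_lmul_matrix inner_commute transpose_matrix_vector)
  obtain B where B: "{u} \<subseteq> B" "pairwise orthogonal B" "\<And>b. b \<in> B \<Longrightarrow> norm b = 1"
    "\<And>b. b \<in> B \<Longrightarrow> \<exists>c. A *v b = c *\<^sub>R b" "card B = DIM(real^'n)"
    using self_adjoint_orthonormal_eigenbasis_extend[of "(*v) A" "{u}"] adj u Au by auto
  have "finite B" using B(5) by (metis card.infinite DIM_positive less_irrefl)
  then obtain h where h: "bij_betw h (UNIV :: 'n set) B"
    using finite_same_card_bij[of "UNIV :: 'n set" B] B(5) by auto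
  have hB: "h j \<in> B" for j using h by (auto simp: bij_betw_def)
  obtain d where d: "\<And>j. A *v h j = d j *\<^sub>R h j" using B(4)[OF hB] by metis
  define Q :: "real^'n^'n" where "Q = (\<chi> i j. h j $ i)"
  have col: "column j Q = h j" for j by (simp add: column_def Q_def vec_eq_iff)
  have "orthogonal (h i) (h j)" if "i \<noteq> j" for i j
    using B(2) hB h that unfolding pairwise_def bij_betw_def inj_on_def by (metis UNIV_I)
  then have "orthogonal_matrix Q"
    unfolding orthogonal_matrix_orthonormal_columns col using B(3)[OF hB] by blast
  moreover have "A ** Q = Q ** diag (\<chi> j. d j)"
  proof -
    have "(A ** Q) $ i $ j = (A *v h j) $ i" for i j
      by (simp add: matrix_matrix_mult_def matrix_vector_mult_def Q_def)
    then show ?thesis by (simp add: vec_eq_iff mult_diag_component d) (simp add: Q_def)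
  qed
  moreover obtain i where "h i = u" using h B(1) by (auto simp: bij_betw_def)
  ultimately show thesis using that col by blast
qed

text \<open>Apply Cauchy-Schwarz to the square of \<open>norm (A *v x)\<close>, written as the inner
  product of \<open>x\<close> with \<open>transpose A *v (A *v x)\<close>, and cancel one
  factor.\<close>

lemma onorm_le_onorm_transpose: "onorm ((*v) A) \<le> onorm ((*v) (transpose A))"
  for A :: "real^'n^'m"
proof (rule onorm_bound)
  show "0 \<le> onorm ((*v) (transpose A))" by (intro onorm_pos_le matrix_vector_mul_bounded_linear)
  fix x
  have "norm (A *v x) * norm (A *v x) = x \<bullet> (transpose A *v (A *v x))"
    by (metis dot_lmul_matrix inner_commute power2_eq_square power2_norm_eq_inner transpose_matrix_vector)
  also have "\<dots> \<le> norm x * (onorm ((*v) (transpose A)) * norm (A *v x))"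
    by (rule order_trans[OF norm_cauchy_schwarz]) (intro mult_left_mono onorm matrix_vector_mul_bounded_linear norm_ge_zero)
  finally have "norm (A *v x) * norm (A *v x) \<le> (onorm ((*v) (transpose A)) * norm x) * norm (A *v x)"
    by (simp add: mult_ac)
  then show "norm (A *v x) \<le> onorm ((*v) (transpose A)) * norm x"
    by (cases "A *v x = 0")
      (auto intro!: mult_nonneg_nonneg onorm_pos_le simp del: transpose_matrix_vector)
qed

lemma onorm_transpose: "onorm ((*v) (transpose A)) = onorm ((*v) A)"
  for A :: "real^'n^'m"
  using onorm_le_onorm_transpose[of A] onorm_le_onorm_transpose[of "transpose A"] by simp

text \<open>Testing the adjoint identity on pairs of basis vectors determines each entry; the result
  is the transpose conjugated by \<open>diag \<pi>\<close>.\<close>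

lemma adjoint_pi_eq:
  fixes \<pi> :: "real^'n" and A :: "real^'n^'n"
  assumes pos: "\<And>i. 0 < \<pi> $ i"
  shows "adjoint_pi \<pi> A = (\<chi> i j. A $ j $ i * \<pi> $ j / \<pi> $ i)"
proof -
  let ?B = "adjoint_pi \<pi> A"
  have adj: "\<forall>f g. inner_pi \<pi> (A *v f) g = inner_pi \<pi> f (?B *v g)"
    unfolding adjoint_pi_def by (rule theI'[OF adjoint_pi_exists_unique[OF pos]])
  have ax: "inner_pi \<pi> f (axis k 1) = f $ k * \<pi> $ k" "inner_pi \<pi> (axis k 1) f = f $ k * \<pi> $ k" for f k
    by (simp_all add: inner_pi_def axis_def if_distrib[of "\<lambda>x. x * _"]
        if_distrib[of "\<lambda>x. _ * x"] cong: if_cong)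
  have "?B $ i $ j = A $ j $ i * \<pi> $ j / \<pi> $ i" for i j
  proof -
    have "inner_pi \<pi> (A *v axis i 1) (axis j 1) = inner_pi \<pi> (axis i 1) (?B *v axis j 1)"
      using adj by blast
    then have "A $ j $ i * \<pi> $ j = ?B $ i $ j * \<pi> $ i"
      by (simp only: ax matrix_vector_mult_basis) (simp add: column_def)
    then show ?thesis using pos[of i] by simp
  qed
  then show ?thesis by (simp add: vec_eq_iff)
qed

text \<open>The range of \<open>transpose W\<close> is orthogonal to \<open>u\<close>, and there
  \<open>transpose S\<close> stretches by at least \<open>sqrt (d $ j0)\<close>, with equality at
  column \<open>j0\<close> of \<open>Q\<close>. Since \<open>transpose W\<close> undoes this
  stretching, its norm is the reciprocal. Transposes appear because \<open>d\<close> diagonalizes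
  \<open>S ** transpose S\<close>.\<close>

lemma onorm_generalized_inverse:
  fixes S W Q :: "real^'n^'n" and u d :: "real^'n"
  defines "E \<equiv> mat 1 - (\<chi> i j. u $ i * u $ j)"
  assumes u: "norm u = 1" and SW: "S ** W = E" and WS: "W ** S = E" and Wu: "W *v u = 0"
    and Q: "orthogonal_matrix Q" and SQ: "(S ** transpose S) ** Q = Q ** diag d"
    and colQ: "column i0 Q = u"
    and j0: "j0 \<noteq> i0" and least: "\<And>j. j \<noteq> i0 \<Longrightarrow> d $ j0 \<le> d $ j"
  shows "0 < d $ j0" and "onorm ((*v) W) = 1 / sqrt (d $ j0)"
proof -
  let ?e = "\<lambda>j. column j Q"
  have E: "E *v x = x - (u \<bullet> x) *\<^sub>R u" for x
    by (simp add: E_def matrix_vector_mult_diff_rdistrib vec_eq_iff)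
      (simp add: matrix_vector_mult_def inner_vec_def sum_distrib_right sum_distrib_left mult_ac)
  have symE: "transpose E = E" by (simp add: E_def transpose_def vec_eq_iff mat_def mult.commute)
  have uu: "u \<bullet> u = 1" using u by (simp add: norm_eq_1)
  have WtSt: "transpose W *v (transpose S *v x) = x - (u \<bullet> x) *\<^sub>R u" for x
    by (metis E SW symE matrix_transpose_mul matrix_vector_mul_assoc)
  have StWt: "transpose S *v (transpose W *v x) = x - (u \<bullet> x) *\<^sub>R u" for x
    by (metis E WS symE matrix_transpose_mul matrix_vector_mul_assoc)
  have QtQ: "transpose Q ** Q = mat 1" and QQt: "Q ** transpose Q = mat 1"
    using Q by (auto simp: orthogonal_matrix_def)
  have norm_St: "(norm (transpose S *v y))\<^sup>2 = (\<Sum>j\<in>UNIV. d $ j * (?e j \<bullet> y)\<^sup>2)" for y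
  proof -
    let ?z = "transpose Q *v y"
    have "(norm (transpose S *v y))\<^sup>2 = y \<bullet> ((S ** transpose S) *v y)"
      by (simp add: power2_norm_eq_inner dot_lmul_matrix flip: matrix_vector_mul_assoc)
    also have "S ** transpose S = (Q ** diag d) ** transpose Q"
      by (metis SQ QQt matrix_mul_assoc matrix_mul_rid)
    also have "y \<bullet> (((Q ** diag d) ** transpose Q) *v y) = ?z \<bullet> (diag d *v ?z)"
      by (simp add: dot_lmul_matrix flip: matrix_vector_mul_assoc)
    also have "\<dots> = (\<Sum>j\<in>UNIV. d $ j * (?z $ j)\<^sup>2)"
      by (simp add: inner_vec_def diag_mult_vec_component power2_eq_square mult_ac)
    finally show ?thesis
      by (simp add: inner_vec_def column_def vector_matrix_mult_def mult.commute)
  qed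
  have norm_Q: "(norm y)\<^sup>2 = (\<Sum>j\<in>UNIV. (?e j \<bullet> y)\<^sup>2)" for y
  proof -
    have "(norm y)\<^sup>2 = y \<bullet> ((Q ** transpose Q) *v y)" by (simp add: QQt power2_norm_eq_inner)
    also have "\<dots> = (norm (transpose Q *v y))\<^sup>2"
      by (simp add: power2_norm_eq_inner dot_lmul_matrix flip: matrix_vector_mul_assoc)
    also have "\<dots> = (\<Sum>j\<in>UNIV. (?e j \<bullet> y)\<^sup>2)"
      unfolding power2_norm_eq_inner
      by (simp add: inner_vec_def vector_matrix_mult_def column_def power2_eq_square mult.commute)
    finally show ?thesis .
  qed
  have orth: "?e i \<bullet> ?e j = (if i = j then 1 else 0)" for i j
    using Q by (auto simp: orthogonal_matrix_orthonormal_columns orthogonal_def norm_eq_1)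
  note transpose_matrix_vector [simp del]
  \<comment> \<open>The extremal vector: \<open>transpose W\<close> sends it to the unit vector
    \<open>?e j0\<close>, which gives both positivity of \<open>d $ j0\<close> and the lower bound
    on the norm.\<close>
  define x where "x = transpose S *v ?e j0"
  have "(norm x)\<^sup>2 = d $ j0"
    by (simp add: x_def norm_St orth if_distrib[of "\<lambda>x. x\<^sup>2"] if_distrib[of "\<lambda>x. _ * x"] cong: if_cong)
  moreover have Wx: "transpose W *v x = ?e j0"
    using orth[of i0 j0] j0 by (simp add: x_def WtSt colQ)
  then have "x \<noteq> 0" using orth[of j0 j0] by auto
  ultimately show pos: "0 < d $ j0" by (metis zero_less_norm_iff zero_less_power)
  have norm_x: "norm x = sqrt (d $ j0)" using \<open>(norm x)\<^sup>2 = d $ j0\<close> by (metis norm_ge_zero real_sqrt_unique)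
  have "onorm ((*v) (transpose W)) = 1 / sqrt (d $ j0)"
  proof (rule antisym)
    show "onorm ((*v) (transpose W)) \<le> 1 / sqrt (d $ j0)"
    proof (rule onorm_bound)
      fix x
      define y where "y = transpose W *v x"
      have "u \<bullet> y = 0" unfolding y_def
        by (metis Wu dot_lmul_matrix inner_commute inner_zero_right transpose_matrix_vector)
      \<comment> \<open>At \<open>j = i0\<close>, where \<open>least\<close> says nothing, both
        sides vanish because \<open>y\<close> is orthogonal to \<open>u\<close>.\<close>
      then have "d $ j0 * (?e j \<bullet> y)\<^sup>2 \<le> d $ j * (?e j \<bullet> y)\<^sup>2" for j
        using least[of j] by (cases "j = i0") (auto simp: colQ intro: mult_right_mono)
      then have "d $ j0 * (norm y)\<^sup>2 \<le> (norm (transpose S *v y))\<^sup>2"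
        unfolding norm_St norm_Q[of y] sum_distrib_left by (rule sum_mono)
      \<comment> \<open>\<open>transpose S *v y\<close> is the projection of \<open>x\<close> off
        \<open>u\<close>, so this is Pythagoras.\<close>
      also have "(norm (transpose S *v y))\<^sup>2 = (norm x)\<^sup>2 - (u \<bullet> x)\<^sup>2"
        unfolding y_def StWt power2_norm_eq_inner
        by (simp add: inner_diff_left inner_diff_right uu inner_commute[of x u] power2_eq_square)
      also have "\<dots> \<le> (norm x)\<^sup>2" by simp
      finally have "sqrt (d $ j0) * norm y \<le> norm x"
        using pos by (metis norm_ge_zero real_sqrt_abs real_sqrt_le_mono real_sqrt_mult abs_of_nonneg)
      then show "norm (transpose W *v x) \<le> 1 / sqrt (d $ j0) * norm x"
        using pos by (simp add: y_def field_simps)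
    qed (use pos in simp)
    have norm_Q_col: "norm (?e j0) = 1" using orth[of j0 j0] by (simp add: norm_eq_1)
    have "norm (transpose W *v x) \<le> onorm ((*v) (transpose W)) * norm x" by (intro onorm matrix_vector_mul_bounded_linear)
    then show "1 / sqrt (d $ j0) \<le> onorm ((*v) (transpose W))"
      using norm_Q_col pos by (simp add: Wx norm_x divide_le_eq mult.commute)
  qed
  then show "onorm ((*v) W) = 1 / sqrt (d $ j0)" by (simp add: onorm_transpose)
qed

text \<open>Removing the one occurrence of 0 at \<open>i0\<close> leaves a sorted list
  \<open>xs\<close> whose head is the least value at the other indices. Singling out an index rather
  than a value allows further zeros in \<open>d\<close>.\<close>

lemma second_least_of_spectrum:
  fixes d :: "real^'n"
  assumes n: "CARD('n) \<ge> 2" and i0: "d $ i0 = 0" and nonneg: "\<And>j. 0 \<le> d $ j"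
  obtains j0 where "j0 \<noteq> i0" "\<And>j. j \<noteq> i0 \<Longrightarrow> d $ j0 \<le> d $ j"
    "rev (map sqrt (sorted_list_of_multiset (image_mset (($) d) (mset_set UNIV)))) ! (CARD('n) - 1 - 1)
      = sqrt (d $ j0)"
proof -
  let ?M = "image_mset (($) d) (mset_set (UNIV - {i0}))"
  define xs where "xs = sorted_list_of_multiset ?M"
  have set_xs: "set xs = ($) d ` (UNIV - {i0})" by (simp add: xs_def)
  have len: "length xs = CARD('n) - 1"
    by (metis (mono_tags) xs_def mset_sorted_list_of_multiset size_image_mset size_mset size_mset_set card_Diff_singleton UNIV_I)
  have "mset_set UNIV = add_mset i0 (mset_set (UNIV - {i0}))"
    by (simp add: mset_set.remove)
  then have "sorted_list_of_multiset (image_mset (($) d) (mset_set UNIV)) = insort 0 xs"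
    by (simp add: xs_def i0)
  also have "\<dots> = 0 # xs" using set_xs nonneg by (intro insort_is_Cons) auto
  finally have *: "rev (map sqrt (sorted_list_of_multiset (image_mset (($) d) (mset_set UNIV)))) ! (CARD('n) - 1 - 1)
      = rev (map sqrt (0 # xs)) ! (length xs - 1)" by (simp add: len)
  have "xs \<noteq> []" using len n by auto
  \<comment> \<open>In a list of length n, zero-based position n - 2 of the reversal is position 1
    of the list, just after the leading 0.\<close>
  then have "rev (map sqrt (0 # xs)) ! (length xs - 1) = sqrt (xs ! 0)"
    by (subst rev_nth) (auto simp: less_Suc_eq)
  moreover have "xs ! 0 \<in> set xs" using \<open>xs \<noteq> []\<close> by simp
  then obtain j0 where "j0 \<noteq> i0" "xs ! 0 = d $ j0" using set_xs by auto
  moreover have "xs ! 0 \<le> d $ j" if "j \<noteq> i0" for j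
  proof -
    have "d $ j \<in> set xs" using that set_xs by auto
    then obtain k where "k < length xs" "xs ! k = d $ j" by (auto simp: in_set_conv_nth)
    moreover have "sorted xs" by (simp add: xs_def)
    ultimately show ?thesis by (metis sorted_nth_mono le0)
  qed
  ultimately show thesis using that * by metis
qed

section \<open>The series as a generalized inverse of \<open>mat 1 - P\<close>\<close>

lemma matrix_mult_diff_distrib: "A ** (B - C) = A ** B - A ** C"
  and matrix_mult_diff_rdistrib: "(A - B) ** C = A ** C - B ** C"
  for A B C :: "'a::ring_1^'n^'n"
  by (simp_all add: vec_eq_iff matrix_matrix_mult_def algebra_simps sum_subtractf)

lemma bounded_linear_matrix_mult_left: "bounded_linear ((**) A)"
  and bounded_linear_matrix_mult_right: "bounded_linear (\<lambda>B. B ** A)"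
  for A :: "real^'n^'n"
  unfolding linear_conv_bounded_linear[symmetric]
  by (auto intro!: linearI simp: vec_eq_iff matrix_matrix_mult_def
      sum.distrib sum_distrib_left algebra_simps)

lemma bounded_linear_matrix_vector_mult_left: "bounded_linear (\<lambda>B :: real^'n^'m. B *v x)"
  unfolding linear_conv_bounded_linear[symmetric]
  by (auto intro!: linearI simp: matrix_vector_mult_add_rdistrib scaleR_matrix_vector_assoc)

text \<open>Multiplying the terms by \<open>mat 1 - P\<close> makes the series telescope to its
  first term, as the terms tend to 0. Multiplication on the right gives the same series because
  \<open>U_perp1 \<pi>\<close> commutes with \<open>P\<close>. The limit \<open>Z\<close> is the
  deviation matrix of the chain.\<close>

lemma ergodic_series_inverse:
  fixes P :: "real^'n^'n" and \<pi> :: "real^'n"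
  assumes P: "row_stochastic P" and pi: "positive_stationary P \<pi>"
    and summable: "summable (\<lambda>k. matpow P k ** U_perp1 \<pi>)"
  defines "Z \<equiv> (\<Sum>k. matpow P k ** U_perp1 \<pi>)"
  shows "(mat 1 - P) ** Z = U_perp1 \<pi>" and "Z ** (mat 1 - P) = U_perp1 \<pi>" and "Z *v 1 = 0"
proof -
  let ?U = "U_perp1 \<pi>" and ?L = "mat 1 - P"
  let ?f = "\<lambda>k. matpow P k ** ?U"
  have stat: "\<pi> v* P = \<pi>" and sum_pi: "(\<Sum>i\<in>UNIV. \<pi> $ i) = 1"
    using pi by (auto simp: positive_stationary_def)
  have sums: "?f sums Z" unfolding Z_def using summable by (rule summable_sums)
  have L_mult: "?L ** M = M - P ** M" and mult_L: "M ** ?L = M - M ** P" for M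
    by (simp_all add: matrix_mult_diff_distrib matrix_mult_diff_rdistrib)
  have tele: "(\<lambda>k. ?L ** ?f k) sums ?U"
  proof -
    have "(\<lambda>k. ?f k - ?f (Suc k)) sums (?f 0 - 0)"
      by (intro telescope_sums' summable_LIMSEQ_zero summable)
    then show ?thesis by (simp add: L_mult matrix_mult_diff_rdistrib matrix_mul_assoc)
  qed
  moreover have "(\<lambda>k. ?L ** ?f k) sums (?L ** Z)"
    by (rule bounded_linear.sums[OF bounded_linear_matrix_mult_left sums])
  ultimately show "?L ** Z = ?U" by (metis sums_unique2)
  have "?f k ** ?L = ?L ** ?f k" for k
  proof -
    have comm: "matpow P k ** P = P ** matpow P k"
      by (induction k) (simp_all flip: matrix_mul_assoc)
    \<comment> \<open>The rank-one matrix with all rows \<open>\<pi>\<close> absorbs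
      \<open>P\<close> on the right by stationarity and on the left by unit row sums.\<close>
    have "(\<chi> i j. \<pi> $ j) ** P = (\<chi> i j. \<pi> $ j)" "P ** (\<chi> i j. \<pi> $ j) = (\<chi> i j. \<pi> $ j)"
      using stat row_stochastic_sum[OF P]
      by (simp_all add: vec_eq_iff matrix_matrix_mult_def vector_matrix_mult_def flip: sum_distrib_right)
    then have "?U ** P = P ** ?U"
      by (simp add: U_perp1_def matrix_mult_diff_distrib matrix_mult_diff_rdistrib)
    with comm show ?thesis by (simp add: L_mult mult_L) (metis matrix_mul_assoc)
  qed
  then have "(\<lambda>k. ?L ** ?f k) sums (Z ** ?L)"
    using bounded_linear.sums[OF bounded_linear_matrix_mult_right sums, of ?L] by simp
  with tele show "Z ** ?L = ?U" by (metis sums_unique2)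
  have "?f k *v 1 = 0" for k
  proof -
    have "?U *v 1 = 0" using sum_pi by (simp add: U_perp1_mult_vec vec_eq_iff inner_vec_def)
    then show ?thesis by (simp flip: matrix_vector_mul_assoc)
  qed
  then show "Z *v 1 = 0"
    using bounded_linear.sums[OF bounded_linear_matrix_vector_mult_left sums, of 1] by (metis (no_types, lifting) sums_unique2 sums_zero sums_cong)
qed

section \<open>Transfer to Euclidean space and identification of the singular value\<close>

theorem theorem3p9:
  fixes P :: "real^'n^'n" and \<pi> :: "real^'n"
  assumes "CARD('n) \<ge> 2"
    and "row_stochastic P"
    and "irreducible_chain P"
    and "aperiodic_chain P"
    and "positive_stationary P \<pi>"
  shows "spectral_radius (P ** U_perp1 \<pi>) < 1
    \<and> summable (\<lambda>k. matpow P k ** U_perp1 \<pi>)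
    \<and> 0 < singular_value_pi \<pi> (mat 1 - P) (CARD('n) - 1)
    \<and> relaxation_time \<pi> P = 1 / singular_value_pi \<pi> (mat 1 - P) (CARD('n) - 1)
    \<and> onorm ((*v) (diag (\<chi> i. sqrt (\<pi> $ i)) ** (\<Sum>k. matpow P k ** U_perp1 \<pi>)
                      ** diag (\<chi> i. 1 / sqrt (\<pi> $ i))))
        = relaxation_time \<pi> P"
proof -
  define Z where "Z = (\<Sum>k. matpow P k ** U_perp1 \<pi>)"
  define L where "L = mat 1 - P"
  define u where "u = (\<chi> i. sqrt (\<pi> $ i))"
  define D where "D = diag u"
  define D' where "D' = diag (\<chi> i. 1 / u $ i)"
  define S where "S = D ** L ** D'"
  define W where "W = D ** Z ** D'"
  have stat: "\<pi> v* P = \<pi>" and pos: "\<And>i. 0 < \<pi> $ i" and sum_pi: "(\<Sum>i\<in>UNIV. \<pi> $ i) = 1"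
    using assms(5) by (auto simp: positive_stationary_def)
  have summable: "summable (\<lambda>k. matpow P k ** U_perp1 \<pi>)"
    by (rule ergodic_summable[OF assms(2-5)])
  have LZ: "L ** Z = U_perp1 \<pi>" and ZL: "Z ** L = U_perp1 \<pi>" and Z1: "Z *v 1 = 0"
    using ergodic_series_inverse[OF assms(2,5) summable] by (auto simp: L_def Z_def)
  have u_pos: "0 < u $ i" and uu: "u $ i * u $ i = \<pi> $ i" for i
    using pos[of i] by (auto simp: u_def)
  have DD': "D ** D' = mat 1" "D' ** D = mat 1"
    using less_imp_neq[OF u_pos]
    by (auto simp: D_def D'_def vec_eq_iff diag_mult_component mat_def)
      (auto simp: diag_def)
  have cancel: "D ** (D' ** X) = X" "D' ** (D ** X) = X" for X
    by (simp_all add: DD' matrix_mul_assoc)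
  have norm_u: "norm u = 1" by (simp add: norm_eq_1 inner_vec_def uu sum_pi)
  have "D' *v u = 1"
    using less_imp_neq[OF u_pos] by (simp add: D'_def vec_eq_iff diag_mult_vec_component)
  then have Wu: "W *v u = 0"
    by (simp add: W_def Z1 flip: matrix_vector_mul_assoc)
  \<comment> \<open>The factor \<open>u $ i * \<pi> $ j / u $ j\<close> equals
    \<open>u $ i * u $ j\<close>, so the oblique projection becomes orthogonal.\<close>
  have conj: "D ** U_perp1 \<pi> ** D' = mat 1 - (\<chi> i j. u $ i * u $ j)"
    using less_imp_neq[OF u_pos]
    by (simp add: vec_eq_iff D_def D'_def diag_mult_component mult_diag_component U_perp1_def mat_def
        right_diff_distrib diff_divide_distrib flip: uu)
  have SW: "S ** W = mat 1 - (\<chi> i j. u $ i * u $ j)"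
  proof -
    have "S ** W = D ** L ** (D' ** D) ** Z ** D'" by (simp add: S_def W_def matrix_mul_assoc)
    also have "\<dots> = D ** (L ** Z) ** D'" by (simp add: DD' matrix_mul_assoc)
    finally show ?thesis by (simp add: LZ conj)
  qed
  have WS: "W ** S = mat 1 - (\<chi> i j. u $ i * u $ j)"
  proof -
    have "W ** S = D ** Z ** (D' ** D) ** L ** D'" by (simp add: S_def W_def matrix_mul_assoc)
    also have "\<dots> = D ** (Z ** L) ** D'" by (simp add: DD' matrix_mul_assoc)
    finally show ?thesis by (simp add: ZL conj)
  qed
  define A where "A = S ** transpose S"
  have "transpose A = A" by (simp add: A_def matrix_transpose_mul)
  have "\<pi> v* L = 0" by (simp add: L_def vector_matrix_mult_diff_rdistrib stat)
  \<comment> \<open>\<open>D\<close> maps \<open>u\<close> to \<open>\<pi>\<close>, so stationarity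
    is what puts \<open>u\<close> in this kernel.\<close>
  have "transpose S *v u = 0"
  proof -
    have "(transpose S *v u) $ j = (\<pi> v* L) $ j / u $ j" for j
      unfolding S_def
      by (simp add: vector_matrix_mult_def diag_mult_component mult_diag_component D_def D'_def
          sum_divide_distrib mult_ac flip: uu)
    then show ?thesis by (simp add: vec_eq_iff \<open>\<pi> v* L = 0\<close>)
  qed
  then have "A *v u = 0 *\<^sub>R u" unfolding A_def by (metis matrix_vector_mul_assoc matrix_vector_mult_0_right scaleR_zero_left)
  with \<open>transpose A = A\<close> norm_u obtain Q d i0
    where Q: "orthogonal_matrix Q" and AQ: "A ** Q = Q ** diag d" and col: "column i0 Q = u"
    using spectral_decomposition_with_eigenvector by metis
  \<comment> \<open>The eigenvalues are Rayleigh quotients of \<open>S ** transpose S\<close>, hence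
    nonnegative and zero at \<open>i0\<close>.\<close>
  have d: "d $ j = (norm (transpose S *v column j Q))\<^sup>2" for j
  proof -
    have "A *v column j Q = d $ j *\<^sub>R column j Q"
    proof -
      have "(A *v column j Q) $ i = (A ** Q) $ i $ j" for i
        by (simp add: matrix_vector_mult_def matrix_matrix_mult_def column_def)
      then show ?thesis by (simp add: AQ vec_eq_iff mult_diag_component column_def)
    qed
    then have "d $ j * (norm (column j Q))\<^sup>2 = column j Q \<bullet> (A *v column j Q)"
      by (simp add: power2_norm_eq_inner)
    also have "\<dots> = (norm (transpose S *v column j Q))\<^sup>2"
      by (simp add: A_def power2_norm_eq_inner dot_lmul_matrix flip: matrix_vector_mul_assoc)
    finally show ?thesis using Q by (simp add: orthogonal_matrix_orthonormal_columns)
  qed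
  have "d $ i0 = 0" using \<open>transpose S *v u = 0\<close> by (simp add: d col)
  moreover have "0 \<le> d $ j" for j by (simp add: d)
  ultimately obtain j0 where j0: "j0 \<noteq> i0" and least: "\<And>j. j \<noteq> i0 \<Longrightarrow> d $ j0 \<le> d $ j"
    and nth: "rev (map sqrt (sorted_list_of_multiset (image_mset (($) d) (mset_set UNIV)))) ! (CARD('n) - 1 - 1)
      = sqrt (d $ j0)"
    using second_least_of_spectrum[OF assms(1)] by blast
  have W: "0 < d $ j0" "onorm ((*v) W) = 1 / sqrt (d $ j0)"
    using onorm_generalized_inverse[OF norm_u SW WS Wu Q AQ[unfolded A_def] col j0 least] by auto
  \<comment> \<open>As \<open>D\<close> squared is \<open>diag \<pi>\<close>, the weighted adjoint
    is conjugate by \<open>D\<close> to the ordinary transpose of \<open>S\<close>. This makes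
    \<open>L ** adjoint_pi \<pi> L\<close> similar to \<open>A\<close>.\<close>
  have "adjoint_pi \<pi> L = D' ** (D' ** transpose L ** D) ** D"
    using less_imp_neq[OF u_pos]
    by (simp add: adjoint_pi_eq[OF pos] vec_eq_iff D_def D'_def diag_mult_component mult_diag_component
        transpose_def flip: uu)
  moreover have "transpose S = D' ** transpose L ** D"
    by (simp add: S_def matrix_transpose_mul matrix_mul_assoc D_def D'_def transpose_diag)
  ultimately have "(L ** adjoint_pi \<pi> L) ** D' = D' ** A"
    by (simp add: A_def S_def cancel DD' flip: matrix_mul_assoc)
  \<comment> \<open>\<open>D' ** Q\<close> is not orthogonal in general, but an explicit inverse
    suffices to read off the roots with multiplicity.\<close>
  then have "(L ** adjoint_pi \<pi> L) ** (D' ** Q) = (D' ** Q) ** diag d"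
    by (metis AQ matrix_mul_assoc)
  moreover have "(D' ** Q) ** (transpose Q ** D) = mat 1"
  proof -
    have "Q ** (transpose Q ** D) = D"
      using Q by (simp add: orthogonal_matrix_def matrix_mul_assoc)
    then show ?thesis by (simp add: DD' flip: matrix_mul_assoc)
  qed
  ultimately have "proots (charpoly (L ** adjoint_pi \<pi> L)) = image_mset (($) d) (mset_set UNIV)"
    by (rule proots_charpoly_similar_diag)
  then have sv: "singular_value_pi \<pi> L (CARD('n) - 1) = sqrt (d $ j0)"
    unfolding singular_value_pi_def singular_values_pi_def by (simp only: nth)
  have "onorm ((*v) W) = relaxation_time \<pi> P"
    using W sv by (simp add: relaxation_time_def L_def)
  moreover have "W = diag (\<chi> i. sqrt (\<pi> $ i)) ** (\<Sum>k. matpow P k ** U_perp1 \<pi>) ** diag (\<chi> i. 1 / sqrt (\<pi> $ i))"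
    by (simp add: W_def Z_def D_def D'_def u_def)
  ultimately show ?thesis
    using ergodic_spectral_radius_less_1[OF assms(2-5)] summable W(1) sv
    by (simp add: relaxation_time_def L_def)
qed

end
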